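(* Let $\boldsymbol{A}$ be a finite pseudocomplemented distributive lattice. Then $\boldsymbol{A}$ embeds into the free pseudocomplemented distributive lattice $\boldsymbol{F}_{\mathsf{PDL}}(\aleph_0)$ on countably infinitely many free generators if and only if the poset $\boldsymbol{A}_*$ has a free skeleton.
   Context: A pseudocomplemented distributive lattice is an algebra $\langle A;\wedge,\vee,\neg,0,1\rangle$ with $\langle A;\wedge,\vee,0,1\rangle$ a bounded distributive lattice and $a\leq\neg b\iff a\wedge b=0$ for all $a,b$; $\mathsf{PDL}$ is the variety of these algebras. For a finite $\boldsymbol{A}\in\mathsf{PDL}$, $\boldsymbol{A}_*$ is the poset of prime filters of its bounded lattice reduct ordered by inclusion (prime filters are proper and nonempty). For a poset $X$ and $x\in X$, ${\uparrow}x=\{y\in X:x\leq y\}$, and for $Y\subseteq X$, $\max Y$ is the set of maximal elements of the subposet $Y$. A poset $X$ with minimum $\bot$ has a free skeleton when there are elements $s_{x,Y}\in X$, for $x\in X$ and nonempty $Y\subseteq\max{\uparrow}x$, such that: (i) for all $x\in X$ and nonempty $Y\subseteq\max{\uparrow}x$, $s_{x,Y}\in{\uparrow}x$ and $Y=\max{\uparrow}s_{x,Y}$; (ii) for all $x\in X$ and nonempty $Y,Z\subseteq\max{\uparrow}x$, $Y\subseteq Z$ implies $s_{x,Z}\leq s_{x,Y}$; (iii) for all $x\in X$ and nonempty $Y\subseteq\max X$, $\max{\uparrow}x\subseteq Y$ implies $s_{\bot,Y}\leq x$. (Having a free skeleton includes having a minimum.) *)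

theory Defs
  imports Main
begin

section \<open>Pseudocomplemented distributive lattices\<close>

text \<open>The one-element algebra is included, since \<^class>\<open>bounded_lattice\<close> does not require
  \<^prop>\<open>bot \<noteq> top\<close>.\<close>

class pseudocomplemented_distrib_lattice = distrib_lattice + bounded_lattice + uminus +
  assumes le_uminus_iff: "a \<le> - b \<longleftrightarrow> inf a b = bot"

definition pdl_hom ::
  "('a::pseudocomplemented_distrib_lattice \<Rightarrow> 'b::pseudocomplemented_distrib_lattice) \<Rightarrow> bool" where
  "pdl_hom h \<longleftrightarrow>
     (\<forall>x y. h (inf x y) = inf (h x) (h y)) \<and>
     (\<forall>x y. h (sup x y) = sup (h x) (h y)) \<and>
     (\<forall>x. h (- x) = - h x) \<and>
     h bot = bot \<and> h top = top"

definition pdl_embedding ::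
  "('a::pseudocomplemented_distrib_lattice \<Rightarrow> 'b::pseudocomplemented_distrib_lattice) \<Rightarrow> bool" where
  "pdl_embedding h \<longleftrightarrow> pdl_hom h \<and> inj h"


section \<open>The free algebra\<close>

datatype 'v pdl_term =
    Var 'v
  | Zero
  | One
  | Meet "'v pdl_term" "'v pdl_term"
  | Join "'v pdl_term" "'v pdl_term"
  | Neg "'v pdl_term"

text \<open>The least congruence on the term algebra whose quotient is a pseudocomplemented distributive
  lattice. The last two rules are the two directions of \<open>t \<le> \<not> u \<longleftrightarrow> t \<and> u = 0\<close>, with \<open>t \<le> \<not> u\<close>
  read as \<open>t \<and> \<not> u = t\<close>.\<close>

inductive pdl_eq :: "'v pdl_term \<Rightarrow> 'v pdl_term \<Rightarrow> bool" where
  refl: "pdl_eq t t"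
| sym: "pdl_eq t u \<Longrightarrow> pdl_eq u t"
| trans: "pdl_eq t u \<Longrightarrow> pdl_eq u w \<Longrightarrow> pdl_eq t w"
| Meet_cong: "pdl_eq t t' \<Longrightarrow> pdl_eq u u' \<Longrightarrow> pdl_eq (Meet t u) (Meet t' u')"
| Join_cong: "pdl_eq t t' \<Longrightarrow> pdl_eq u u' \<Longrightarrow> pdl_eq (Join t u) (Join t' u')"
| Neg_cong: "pdl_eq t t' \<Longrightarrow> pdl_eq (Neg t) (Neg t')"
| Meet_comm: "pdl_eq (Meet t u) (Meet u t)"
| Join_comm: "pdl_eq (Join t u) (Join u t)"
| Meet_assoc: "pdl_eq (Meet (Meet t u) w) (Meet t (Meet u w))"
| Join_assoc: "pdl_eq (Join (Join t u) w) (Join t (Join u w))"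
| Meet_absorb: "pdl_eq (Meet t (Join t u)) t"
| Join_absorb: "pdl_eq (Join t (Meet t u)) t"
| Join_distrib: "pdl_eq (Join t (Meet u w)) (Meet (Join t u) (Join t w))"
| Join_Zero: "pdl_eq (Join t Zero) t"
| Meet_One: "pdl_eq (Meet t One) t"
| Neg_disjoint: "pdl_eq (Meet t (Neg u)) t \<Longrightarrow> pdl_eq (Meet t u) Zero"
| Neg_greatest: "pdl_eq (Meet t u) Zero \<Longrightarrow> pdl_eq (Meet t (Neg u)) t"

quotient_type 'v free_pdl = "'v pdl_term" / pdl_eq
  by (intro equivpI reflpI sympI transpI) (blast intro: pdl_eq.refl pdl_eq.sym pdl_eq.trans)+

lift_definition free_gen :: "'v \<Rightarrow> 'v free_pdl" is Var .

instantiation free_pdl :: (type) pseudocomplemented_distrib_lattice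
begin

lift_definition inf_free_pdl :: "'a free_pdl \<Rightarrow> 'a free_pdl \<Rightarrow> 'a free_pdl" is Meet
  by (rule pdl_eq.Meet_cong)

lift_definition sup_free_pdl :: "'a free_pdl \<Rightarrow> 'a free_pdl \<Rightarrow> 'a free_pdl" is Join
  by (rule pdl_eq.Join_cong)

lift_definition uminus_free_pdl :: "'a free_pdl \<Rightarrow> 'a free_pdl" is Neg
  by (rule pdl_eq.Neg_cong)

lift_definition bot_free_pdl :: "'a free_pdl" is Zero .

lift_definition top_free_pdl :: "'a free_pdl" is One .

definition less_eq_free_pdl :: "'a free_pdl \<Rightarrow> 'a free_pdl \<Rightarrow> bool" where
  "less_eq_free_pdl x y \<longleftrightarrow> inf x y = x"

definition less_free_pdl :: "'a free_pdl \<Rightarrow> 'a free_pdl \<Rightarrow> bool" where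
  "less_free_pdl x y \<longleftrightarrow> x \<le> y \<and> \<not> y \<le> x"

instance
proof
  have ic: "inf a b = inf b a" for a b :: "'a free_pdl"
    by transfer (rule pdl_eq.Meet_comm)
  have sc: "sup a b = sup b a" for a b :: "'a free_pdl"
    by transfer (rule pdl_eq.Join_comm)
  have ia: "inf (inf a b) c = inf a (inf b c)" for a b c :: "'a free_pdl"
    by transfer (rule pdl_eq.Meet_assoc)
  have sa: "sup (sup a b) c = sup a (sup b c)" for a b c :: "'a free_pdl"
    by transfer (rule pdl_eq.Join_assoc)
  have ab1: "inf a (sup a b) = a" for a b :: "'a free_pdl"
    by transfer (rule pdl_eq.Meet_absorb)
  have ab2: "sup a (inf a b) = a" for a b :: "'a free_pdl"
    by transfer (rule pdl_eq.Join_absorb)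
  have s0: "sup a bot = a" for a :: "'a free_pdl"
    by transfer (rule pdl_eq.Join_Zero)
  have i1: "inf a top = a" for a :: "'a free_pdl"
    by transfer (rule pdl_eq.Meet_One)
  have ii: "inf a a = a" for a :: "'a free_pdl"
    by (metis ab1 ab2)
  have le_sup: "a \<le> b \<longleftrightarrow> sup a b = b" for a b :: "'a free_pdl"
    unfolding less_eq_free_pdl_def by (metis ab1 ab2 ic sc)
  fix x y z :: "'a free_pdl"
  show "x < y \<longleftrightarrow> x \<le> y \<and> \<not> y \<le> x"
    by (rule less_free_pdl_def)
  show "x \<le> x"
    by (simp add: less_eq_free_pdl_def ii)
  show "x \<le> y \<Longrightarrow> y \<le> z \<Longrightarrow> x \<le> z"
    unfolding less_eq_free_pdl_def by (metis ia)
  show "x \<le> y \<Longrightarrow> y \<le> x \<Longrightarrow> x = y"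
    unfolding less_eq_free_pdl_def by (metis ic)
  show "inf x y \<le> x" "inf x y \<le> y"
    unfolding less_eq_free_pdl_def by (metis ia ic ii)+
  show "x \<le> y \<Longrightarrow> x \<le> z \<Longrightarrow> x \<le> inf y z"
    unfolding less_eq_free_pdl_def by (metis ia)
  show "x \<le> sup x y" "y \<le> sup x y"
    unfolding less_eq_free_pdl_def by (metis ab1 sc)+
  show "y \<le> x \<Longrightarrow> z \<le> x \<Longrightarrow> sup y z \<le> x"
    unfolding le_sup by (metis sa)
  show "sup x (inf y z) = inf (sup x y) (sup x z)"
    by transfer (rule pdl_eq.Join_distrib)
  show "bot \<le> x"
    unfolding le_sup by (metis s0 sc)
  show "x \<le> top"
    by (simp add: less_eq_free_pdl_def i1)
  show "x \<le> - y \<longleftrightarrow> inf x y = bot"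
    unfolding less_eq_free_pdl_def
    by transfer (blast intro: pdl_eq.Neg_disjoint pdl_eq.Neg_greatest)
qed

end

primrec pdl_eval :: "('v \<Rightarrow> 'a::pseudocomplemented_distrib_lattice) \<Rightarrow> 'v pdl_term \<Rightarrow> 'a" where
  "pdl_eval f (Var v) = f v"
| "pdl_eval f Zero = bot"
| "pdl_eval f One = top"
| "pdl_eval f (Meet t u) = inf (pdl_eval f t) (pdl_eval f u)"
| "pdl_eval f (Join t u) = sup (pdl_eval f t) (pdl_eval f u)"
| "pdl_eval f (Neg t) = - pdl_eval f t"

lemma pdl_eval_cong: "pdl_eq t u \<Longrightarrow> pdl_eval f t = pdl_eval f u"
proof (induction rule: pdl_eq.induct)
  case (Neg_disjoint t u)
  then show ?case by (simp add: le_iff_inf flip: le_uminus_iff)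
next
  case (Neg_greatest t u)
  then show ?case by (simp add: le_uminus_iff flip: le_iff_inf)
qed (simp_all add: ac_simps sup_inf_distrib1)

lift_definition free_extend ::
  "('v \<Rightarrow> 'a::pseudocomplemented_distrib_lattice) \<Rightarrow> 'v free_pdl \<Rightarrow> 'a" is pdl_eval
  by (rule pdl_eval_cong)

text \<open>\<^typ>\<open>'v free_pdl\<close> is free on \<^const>\<open>free_gen\<close>: every map of the generators into a
  pseudocomplemented distributive lattice extends to a unique homomorphism.\<close>

lemma free_pdl_universal:
  fixes f :: "'v \<Rightarrow> 'a::pseudocomplemented_distrib_lattice"
  shows "\<exists>!h. pdl_hom h \<and> (\<forall>v. h (free_gen v) = f v)"
proof (rule ex1I)
  show "pdl_hom (free_extend f) \<and> (\<forall>v. free_extend f (free_gen v) = f v)"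
    unfolding pdl_hom_def by (intro conjI allI; transfer; simp)
next
  fix h assume h: "pdl_hom h \<and> (\<forall>v. h (free_gen v) = f v)"
  have "h (abs_free_pdl t) = pdl_eval f t" for t
    using h unfolding pdl_hom_def
    by (induction t)
      (simp_all flip: inf_free_pdl.abs_eq sup_free_pdl.abs_eq uminus_free_pdl.abs_eq
        bot_free_pdl.abs_eq top_free_pdl.abs_eq free_gen.abs_eq)
  then show "h = free_extend f"
    by (metis ext free_extend.abs_eq Quotient_free_pdl Quotient_abs_rep)
qed

instance bool :: pseudocomplemented_distrib_lattice
  by standard auto

lemma inj_free_gen: "inj free_gen"
proof (rule injI)
  fix v w :: 'v assume eq: "free_gen v = free_gen w"
  obtain h :: "'v free_pdl \<Rightarrow> bool" where "\<forall>u. h (free_gen u) = (u = v)"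
    using free_pdl_universal[of "\<lambda>u. u = v"] by blast
  with eq show "v = w" by metis
qed


section \<open>Prime filters\<close>

definition prime_filter :: "'a::bounded_lattice set \<Rightarrow> bool" where
  "prime_filter F \<longleftrightarrow>
     F \<noteq> {} \<and> F \<noteq> UNIV \<and>
     (\<forall>x y. x \<in> F \<and> x \<le> y \<longrightarrow> y \<in> F) \<and>
     (\<forall>x y. x \<in> F \<and> y \<in> F \<longrightarrow> inf x y \<in> F) \<and>
     (\<forall>x y. sup x y \<in> F \<longrightarrow> x \<in> F \<or> y \<in> F)"

text \<open>The carrier of \<open>A\<^sub>*\<close>; its order is inclusion, the order of the type of sets.\<close>

definition prime_filters :: "'a::bounded_lattice set set" where
  "prime_filters = {F. prime_filter F}"


section \<open>Free skeletons\<close>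

text \<open>A poset is given as a subset \<open>X\<close> of an ordered type, with the induced order.\<close>

definition up_in :: "'b::order set \<Rightarrow> 'b \<Rightarrow> 'b set" where
  "up_in X x = {y \<in> X. x \<le> y}"

definition max_elems :: "'b::order set \<Rightarrow> 'b set" where
  "max_elems Y = {y \<in> Y. \<forall>z \<in> Y. y \<le> z \<longrightarrow> z = y}"

definition has_free_skeleton :: "'b::order set \<Rightarrow> bool" where
  "has_free_skeleton X \<longleftrightarrow>
     (\<exists>m \<in> X. (\<forall>x \<in> X. m \<le> x) \<and>
       (\<exists>s :: 'b \<Rightarrow> 'b set \<Rightarrow> 'b.
         (\<forall>x \<in> X. \<forall>Y. Y \<noteq> {} \<and> Y \<subseteq> max_elems (up_in X x) \<longrightarrow>
            s x Y \<in> up_in X x \<and> Y = max_elems (up_in X (s x Y))) \<and>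
         (\<forall>x \<in> X. \<forall>Y Z. Y \<noteq> {} \<and> Z \<noteq> {} \<and>
            Y \<subseteq> max_elems (up_in X x) \<and> Z \<subseteq> max_elems (up_in X x) \<and> Y \<subseteq> Z \<longrightarrow>
            s x Z \<le> s x Y) \<and>
         (\<forall>x \<in> X. \<forall>Y. Y \<noteq> {} \<and> Y \<subseteq> max_elems X \<and> max_elems (up_in X x) \<subseteq> Y \<longrightarrow>
            s m Y \<le> x)))"

end

theory Submission
  imports Defs
begin

text \<open>The proof dualises the embedding and reads the result off the shape of the dual of the free
  algebra.

  Prime filters of the free algebra on \<open>V\<close> have a concrete description. Call a subset of \<open>V\<close> a
  colour. A prime filter \<open>R\<close> has its own colour \<open>c\<close>, the set of generators in \<open>R\<close>, and the set \<open>M\<close>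
  of colours of the maximal prime filters above \<open>R\<close>. A pseudocomplement at \<open>R\<close> depends only on those
  maximal filters, where every term takes its classical truth value, so the pair \<open>(c, M)\<close>
  determines \<open>R\<close> (\<open>prime_filter_eq_point_filter\<close>). Conversely, each pair with \<open>M\<close> nonempty and \<open>c\<close>
  contained in every member of \<open>M\<close> is a point, that is, comes from a prime filter. The pair grows
  when \<open>c\<close> grows and \<open>M\<close> shrinks, and the maximal points above \<open>(c, M)\<close> are the \<open>(d, {d})\<close> with
  \<open>d \<in> M\<close>.

  Dually, an embedding of a finite \<open>A\<close> gives a cover: an order-preserving map \<open>k\<close> from
  the points onto \<open>A\<^sub>*\<close> that sends the maximal points above \<open>(c, M)\<close> exactly onto the maximal
  elements above \<open>k c M\<close>. Conversely, a cover gives an embedding by sending \<open>a\<close> to the element of the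
  free algebra that holds exactly at the points with \<open>a \<in> k c M\<close>; this element exists if \<open>k\<close> looks
  only at a finite set of generators (\<open>definable_upset\<close>).

  It remains to compare covers with free skeletons. Given a cover and \<open>x = k c M\<close>, every nonempty
  \<open>Y \<subseteq> max \<up>x\<close> is realised above \<open>x\<close> by keeping in \<open>M\<close> only the colours that \<open>k\<close> sends into \<open>Y\<close>,
  and the image of that smaller point is \<open>s x Y\<close>. Conversely, given a free skeleton, reserve for
  every \<open>x\<close> a private block of colours, one for each element of \<open>max \<up>x\<close>. A point whose \<open>M\<close> lies in
  the block of \<open>x\<close> is sent to \<open>s x Y\<close>, and any other to \<open>s \<bottom> Y\<close>, where \<open>Y\<close> is the set of maximal
  elements named by \<open>M\<close>; only a maximal point \<open>(d, {d})\<close> is sent directly to the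
  element named by \<open>d\<close>. The third skeleton condition is what makes this map monotone when a point
  outside all blocks lies below a point in a block.\<close>

section \<open>Prime filters and pseudocomplements\<close>

definition lattice_filter :: "'a::lattice set \<Rightarrow> bool" where
  "lattice_filter F \<longleftrightarrow> F \<noteq> {} \<and> (\<forall>x y. x \<in> F \<and> x \<le> y \<longrightarrow> y \<in> F) \<and>
     (\<forall>x y. x \<in> F \<and> y \<in> F \<longrightarrow> inf x y \<in> F)"

definition adjoin :: "'a::lattice set \<Rightarrow> 'a \<Rightarrow> 'a set" where
  "adjoin F x = {z. \<exists>r\<in>F. inf r x \<le> z}"

lemma prime_filter_lattice_filter: "prime_filter F \<Longrightarrow> lattice_filter F"
  unfolding prime_filter_def lattice_filter_def by blast

lemma lattice_filter_adjoin:
  assumes "lattice_filter F"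
  shows "lattice_filter (adjoin F x)"
  unfolding lattice_filter_def adjoin_def
proof (intro conjI allI impI)
  show "{z. \<exists>r\<in>F. inf r x \<le> z} \<noteq> {}"
    using assms unfolding lattice_filter_def by blast
next
  fix y z assume "y \<in> {z. \<exists>r\<in>F. inf r x \<le> z} \<and> y \<le> z"
  then show "z \<in> {z. \<exists>r\<in>F. inf r x \<le> z}" by (auto intro: order_trans)
next
  fix y z assume "y \<in> {z. \<exists>r\<in>F. inf r x \<le> z} \<and> z \<in> {z. \<exists>r\<in>F. inf r x \<le> z}"
  then obtain r s where rs: "r \<in> F" "inf r x \<le> y" "s \<in> F" "inf s x \<le> z" by blast
  have "inf (inf r s) x \<le> inf y z"
    using rs(2,4) by (meson inf_greatest inf_le1 inf_le2 inf_mono order_refl order_trans)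
  moreover have "inf r s \<in> F" using assms rs unfolding lattice_filter_def by blast
  ultimately show "inf y z \<in> {z. \<exists>r\<in>F. inf r x \<le> z}" by blast
qed

lemma adjoin_superset: "lattice_filter F \<Longrightarrow> F \<subseteq> adjoin F x"
  unfolding adjoin_def by (auto intro: inf_le1)

lemma adjoin_mem: "lattice_filter F \<Longrightarrow> x \<in> adjoin F x"
  unfolding adjoin_def lattice_filter_def by (auto intro: inf_le2)

text \<open>The prime filter theorem. A filter that is maximal among those avoiding an ideal is prime by
  distributivity. The conclusion keeps the maximality because for the ideal \<open>{\<bottom>}\<close> it says that
  the prime filter is maximal.\<close>

lemma prime_filter_extension:
  fixes G I :: "'a::{distrib_lattice, bounded_lattice} set"
  assumes G: "lattice_filter G" and disj: "G \<inter> I = {}" and ne: "I \<noteq> {}"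
    and down: "\<And>x y. y \<in> I \<Longrightarrow> x \<le> y \<Longrightarrow> x \<in> I"
    and join: "\<And>x y. x \<in> I \<Longrightarrow> y \<in> I \<Longrightarrow> sup x y \<in> I"
  obtains R where "prime_filter R" "G \<subseteq> R" "R \<inter> I = {}"
    "\<And>R'. lattice_filter R' \<Longrightarrow> R \<subseteq> R' \<Longrightarrow> R' \<inter> I = {} \<Longrightarrow> R' = R"
proof -
  define \<A> where "\<A> = {R. lattice_filter R \<and> G \<subseteq> R \<and> R \<inter> I = {}}"
  have "\<A> \<noteq> {}" using G disj unfolding \<A>_def by blast
  moreover have "\<Union>\<C> \<in> \<A>" if C: "\<C> \<noteq> {}" "subset.chain \<A> \<C>" for \<C>
  proof -
    have sub: "\<C> \<subseteq> \<A>" and tot: "\<And>U V. U \<in> \<C> \<Longrightarrow> V \<in> \<C> \<Longrightarrow> U \<subseteq> V \<or> V \<subseteq> U"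
      using C(2) unfolding subset_chain_def by auto
    have fil: "lattice_filter U" "G \<subseteq> U" "U \<inter> I = {}" if "U \<in> \<C>" for U
      using sub that unfolding \<A>_def by auto
    have "lattice_filter (\<Union>\<C>)"
      unfolding lattice_filter_def
    proof (intro conjI allI impI)
      show "\<Union>\<C> \<noteq> {}" using C(1) fil(1) unfolding lattice_filter_def by blast
    next
      fix x y assume "x \<in> \<Union>\<C> \<and> x \<le> y"
      then show "y \<in> \<Union>\<C>" using fil(1) unfolding lattice_filter_def by blast
    next
      fix x y assume "x \<in> \<Union>\<C> \<and> y \<in> \<Union>\<C>"
      then obtain U where "U \<in> \<C>" "x \<in> U" "y \<in> U" using tot by blast
      then show "inf x y \<in> \<Union>\<C>" using fil(1) unfolding lattice_filter_def by blast
    qed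
    then show ?thesis using C(1) fil unfolding \<A>_def by blast
  qed
  ultimately obtain R where R: "R \<in> \<A>" "\<And>R'. R' \<in> \<A> \<Longrightarrow> R \<subseteq> R' \<Longrightarrow> R' = R"
    using subset_Zorn_nonempty[of \<A>] by blast
  have fR: "lattice_filter R" and GR: "G \<subseteq> R" and RI: "R \<inter> I = {}"
    using R(1) unfolding \<A>_def by auto
  have max: "R' = R" if "lattice_filter R'" "R \<subseteq> R'" "R' \<inter> I = {}" for R'
    using R(2) that GR unfolding \<A>_def by blast
  have meets: "\<exists>r\<in>R. \<exists>i\<in>I. inf r x \<le> i" if "x \<notin> R" for x
  proof -
    have "adjoin R x \<inter> I \<noteq> {}"
      using max[OF lattice_filter_adjoin[OF fR] adjoin_superset[OF fR]] adjoin_mem[OF fR] that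
      by blast
    then show ?thesis unfolding adjoin_def by blast
  qed
  have "x \<in> R \<or> y \<in> R" if xy: "sup x y \<in> R" for x y
  proof (rule ccontr)
    assume "\<not> (x \<in> R \<or> y \<in> R)"
    then obtain r i s j where ri: "r \<in> R" "i \<in> I" "inf r x \<le> i" and sj: "s \<in> R" "j \<in> I" "inf s y \<le> j"
      using meets by meson
    have "inf (inf r s) (sup x y) = sup (inf (inf r s) x) (inf (inf r s) y)"
      by (rule inf_sup_distrib1)
    also have "\<dots> \<le> sup i j"
      using ri(3) sj(3) by (meson inf_le1 inf_le2 inf_mono order_refl order_trans sup_mono)
    finally have "inf (inf r s) (sup x y) \<in> I" using down join ri(2) sj(2) by blast
    moreover have "inf (inf r s) (sup x y) \<in> R"
      using fR ri(1) sj(1) xy unfolding lattice_filter_def by blast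
    ultimately show False using RI by blast
  qed
  moreover have "R \<noteq> UNIV" using ne RI by blast
  ultimately have "prime_filter R"
    using fR unfolding prime_filter_def lattice_filter_def by blast
  then show ?thesis using that GR RI max by blast
qed

lemma prime_filter_separates:
  fixes x y :: "'a::{distrib_lattice, bounded_lattice}"
  assumes "\<not> x \<le> y"
  obtains R where "prime_filter R" "x \<in> R" "y \<notin> R"
proof -
  have "lattice_filter {z. x \<le> z}" unfolding lattice_filter_def by auto
  then obtain R where "prime_filter R" "{z. x \<le> z} \<subseteq> R" "R \<inter> {z. z \<le> y} = {}"
    by (rule prime_filter_extension[where I = "{z. z \<le> y}"]) (use assms in \<open>auto intro: order_trans\<close>)
  then show ?thesis using that by auto
qed

lemma eqI_prime_filters:
  fixes x y :: "'a::{distrib_lattice, bounded_lattice}"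
  assumes "\<And>R. prime_filter R \<Longrightarrow> x \<in> R \<longleftrightarrow> y \<in> R"
  shows "x = y"
  by (metis assms order_antisym prime_filter_separates)

lemma prime_filter_simps:
  assumes "prime_filter F"
  shows "inf x y \<in> F \<longleftrightarrow> x \<in> F \<and> y \<in> F" "sup x y \<in> F \<longleftrightarrow> x \<in> F \<or> y \<in> F"
    "top \<in> F" "bot \<notin> F"
proof -
  have ne: "F \<noteq> {}" "F \<noteq> UNIV" and up: "\<And>x y. x \<in> F \<Longrightarrow> x \<le> y \<Longrightarrow> y \<in> F"
    and "\<And>x y. x \<in> F \<Longrightarrow> y \<in> F \<Longrightarrow> inf x y \<in> F" "\<And>x y. sup x y \<in> F \<Longrightarrow> x \<in> F \<or> y \<in> F"
    using assms unfolding prime_filter_def by blast+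
  then show "inf x y \<in> F \<longleftrightarrow> x \<in> F \<and> y \<in> F" "sup x y \<in> F \<longleftrightarrow> x \<in> F \<or> y \<in> F"
    by (meson inf_le1 inf_le2 sup_ge1 sup_ge2)+
  show "top \<in> F" "bot \<notin> F" using ne up[OF _ top_greatest] up[OF _ bot_least] by blast+
qed

lemma prime_filterI:
  assumes "\<And>x y. inf x y \<in> F \<longleftrightarrow> x \<in> F \<and> y \<in> F" "\<And>x y. sup x y \<in> F \<longleftrightarrow> x \<in> F \<or> y \<in> F"
    "top \<in> F" "bot \<notin> F"
  shows "prime_filter F"
proof -
  have "y \<in> F" if "x \<in> F" "x \<le> y" for x y
    using assms(1)[of x y] that by (simp add: inf_absorb1)
  then show ?thesis using assms unfolding prime_filter_def by blast
qed

abbreviation max_above :: "'b::order set \<Rightarrow> 'b \<Rightarrow> 'b set" where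
  "max_above X x \<equiv> max_elems (up_in X x)"

lemma max_above_iff: "u \<in> max_above X x \<longleftrightarrow> u \<in> X \<and> x \<le> u \<and> (\<forall>z\<in>X. u \<le> z \<longrightarrow> z = u)"
  unfolding max_elems_def up_in_def by (auto intro: order_trans)

lemma max_elems_iff: "u \<in> max_elems X \<longleftrightarrow> u \<in> X \<and> (\<forall>z\<in>X. u \<le> z \<longrightarrow> z = u)"
  unfolding max_elems_def by blast

lemma max_above_least: "(\<And>x. x \<in> X \<Longrightarrow> m \<le> x) \<Longrightarrow> max_above X m = max_elems X"
  unfolding max_elems_def up_in_def by auto

lemma inf_uminus_bot: "inf x (- x) = (bot::'a::pseudocomplemented_distrib_lattice)"
  using le_uminus_iff[of "- x" x] by (simp add: inf_commute)

text \<open>If \<open>-x \<notin> R\<close>, then \<open>x\<close> is disjoint from no element of \<open>R\<close>, so \<open>R\<close> and \<open>x\<close> generate a proper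
  filter, and a maximal extension of it witnesses the failure of the right-hand side. This is the
  only way in which pseudocomplementation is seen by the prime filters.\<close>

lemma uminus_mem_prime_filter_iff:
  fixes x :: "'a::pseudocomplemented_distrib_lattice"
  assumes R: "prime_filter R"
  shows "- x \<in> R \<longleftrightarrow> (\<forall>U \<in> max_above prime_filters R. x \<notin> U)"
proof
  assume neg: "- x \<in> R"
  have "x \<notin> U" if "prime_filter U" "R \<subseteq> U" for U
    using neg that prime_filter_simps(1)[OF that(1), of x "- x"] prime_filter_simps(4)[OF that(1)]
    by (auto simp: inf_uminus_bot)
  then show "\<forall>U \<in> max_above prime_filters R. x \<notin> U"
    by (simp add: max_above_iff prime_filters_def)
next
  assume none: "\<forall>U \<in> max_above prime_filters R. x \<notin> U"
  have fR: "lattice_filter R" using R by (rule prime_filter_lattice_filter)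
  show "- x \<in> R"
  proof (rule ccontr)
    assume nx: "- x \<notin> R"
    have "inf r x \<noteq> bot" if "r \<in> R" for r
      using that nx R unfolding prime_filter_def by (metis le_uminus_iff)
    then have disj: "adjoin R x \<inter> {bot} = {}" unfolding adjoin_def by (auto simp: bot_unique)
    obtain U where U: "prime_filter U" "adjoin R x \<subseteq> U"
      "\<And>V. lattice_filter V \<Longrightarrow> U \<subseteq> V \<Longrightarrow> V \<inter> {bot} = {} \<Longrightarrow> V = U"
      by (rule prime_filter_extension[OF lattice_filter_adjoin[OF fR, of x] disj]) (auto simp: bot_unique)
    have "U \<in> max_above prime_filters R"
      unfolding max_above_iff
    proof (intro conjI ballI impI)
      show "U \<in> prime_filters" using U(1) by (simp add: prime_filters_def)
      show "R \<subseteq> U" using adjoin_superset[OF fR] U(2) by blast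
    next
      fix V assume "V \<in> prime_filters" "U \<subseteq> V"
      then show "V = U"
        using U(3)[of V] by (simp add: prime_filters_def prime_filter_lattice_filter prime_filter_simps(4))
    qed
    moreover have "x \<in> U" using U(2) adjoin_mem[OF fR] by blast
    ultimately show False using none by blast
  qed
qed

lemma max_above_of_maximal: "u \<in> max_above X x \<Longrightarrow> max_above X u = {u}"
  by (auto simp: max_above_iff)

lemma uminus_mem_maximal_iff:
  fixes U :: "'a::pseudocomplemented_distrib_lattice set"
  assumes "U \<in> max_above prime_filters R"
  shows "- x \<in> U \<longleftrightarrow> x \<notin> U"
proof -
  have "prime_filter U" using assms by (auto simp: max_above_iff prime_filters_def)
  then show ?thesis using max_above_of_maximal[OF assms] by (simp add: uminus_mem_prime_filter_iff)
qed

lemma complemented_prime_filter_maximal: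
  fixes U :: "'a::pseudocomplemented_distrib_lattice set"
  assumes "prime_filter U" "R \<subseteq> U" "\<And>x. x \<notin> U \<Longrightarrow> - x \<in> U"
  shows "U \<in> max_above prime_filters R"
proof -
  have "Q = U" if Q: "prime_filter Q" "U \<subseteq> Q" for Q
  proof -
    have "x \<in> U" if "x \<in> Q" for x
    proof (rule ccontr)
      assume "x \<notin> U"
      then have "inf x (- x) \<in> Q" using assms(3) Q prime_filter_simps(1) that by blast
      then show False using prime_filter_simps(4)[OF Q(1)] by (simp add: inf_uminus_bot)
    qed
    then show ?thesis using Q(2) by blast
  qed
  then show ?thesis using assms(1,2) by (auto simp: max_above_iff prime_filters_def)
qed


section \<open>The prime filters of a free algebra\<close>

text \<open>\<open>c\<close> stands for the colour of a prime filter and \<open>M\<close> for colours of maximal prime filters above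
  it, enough of them to decide pseudocomplements; the condition on \<open>c\<close> reflects that the filter is
  included in these.\<close>

definition point :: "'v set \<Rightarrow> 'v set set \<Rightarrow> bool" where
  "point c M \<longleftrightarrow> M \<noteq> {} \<and> (\<forall>d\<in>M. c \<subseteq> d)"

text \<open>Truth of a term at a point. Negation asks for the classical falsity of the term at each maximal
  point above, hence evaluates it in the two-element algebra.\<close>

primrec sat :: "'v set \<Rightarrow> 'v set set \<Rightarrow> 'v pdl_term \<Rightarrow> bool" where
  "sat c M (Var v) = (v \<in> c)"
| "sat c M Zero = False"
| "sat c M One = True"
| "sat c M (Meet t u) = (sat c M t \<and> sat c M u)"
| "sat c M (Join t u) = (sat c M t \<or> sat c M u)"
| "sat c M (Neg t) = (\<forall>d\<in>M. \<not> pdl_eval (\<lambda>v. v \<in> d) t)"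

definition point_filter :: "'v set \<Rightarrow> 'v set set \<Rightarrow> 'v free_pdl set" where
  "point_filter c M = abs_free_pdl ` {t. sat c M t}"

lemma point_singleton [simp]: "point d {d}"
  unfolding point_def by simp

lemma sat_singleton: "sat d {d} t \<longleftrightarrow> pdl_eval (\<lambda>v. v \<in> d) t"
  by (induction t) auto

lemma sat_mono: "sat c M t \<Longrightarrow> c \<subseteq> c' \<Longrightarrow> M' \<subseteq> M \<Longrightarrow> sat c' M' t"
  by (induction t) auto

text \<open>Soundness. For the two rules of pseudocomplementation, a term true at a point is classically
  true at each maximal point above; since \<open>M\<close> is nonempty there is such a point, so \<open>u\<close> and \<open>\<not> u\<close>
  are never true together.\<close>

lemma sat_cong:
  assumes "pdl_eq t u" "point c M"
  shows "sat c M t \<longleftrightarrow> sat c M u"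
  using assms
proof (induction arbitrary: c M rule: pdl_eq.induct)
  case (Neg_cong t t')
  then show ?case by (simp add: pdl_eval_cong)
next
  case (Neg_disjoint t u)
  have "\<not> sat c M u" if "sat c M t"
  proof
    assume u: "sat c M u"
    obtain d where d: "d \<in> M" "c \<subseteq> d" using Neg_disjoint.prems unfolding point_def by blast
    then have "pdl_eval (\<lambda>v. v \<in> d) u"
      using u sat_mono[of c M u d "{d}"] by (simp add: sat_singleton)
    then show False using Neg_disjoint that d by auto
  qed
  then show ?case by auto
next
  case (Neg_greatest t u)
  have "\<not> pdl_eval (\<lambda>v. v \<in> d) u" if "sat c M t" "d \<in> M" for d
  proof -
    have "c \<subseteq> d" using Neg_greatest.prems that unfolding point_def by blast
    then have "pdl_eval (\<lambda>v. v \<in> d) t"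
      using that sat_mono[of c M t d "{d}"] by (simp add: sat_singleton)
    then show ?thesis using pdl_eval_cong[OF Neg_greatest.hyps, of "\<lambda>v. v \<in> d"] by simp
  qed
  then show ?case by auto
qed auto

lemma abs_free_pdl_cases: obtains t where "z = abs_free_pdl t"
  by (metis Quotient_abs_rep Quotient_free_pdl)

lemma mem_point_filter_iff:
  assumes "point c M"
  shows "abs_free_pdl t \<in> point_filter c M \<longleftrightarrow> sat c M t"
  unfolding point_filter_def using sat_cong[OF _ assms] free_pdl.abs_eq_iff by fastforce

lemma point_filter_simps:
  assumes "point c M"
  shows "free_gen v \<in> point_filter c M \<longleftrightarrow> v \<in> c"
    "bot \<notin> point_filter c M" "top \<in> point_filter c M"
    "inf x y \<in> point_filter c M \<longleftrightarrow> x \<in> point_filter c M \<and> y \<in> point_filter c M"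
    "sup x y \<in> point_filter c M \<longleftrightarrow> x \<in> point_filter c M \<or> y \<in> point_filter c M"
    "- x \<in> point_filter c M \<longleftrightarrow> (\<forall>d\<in>M. x \<notin> point_filter d {d})"
proof -
  obtain t u where tu: "x = abs_free_pdl t" "y = abs_free_pdl u" by (metis abs_free_pdl_cases)
  show "free_gen v \<in> point_filter c M \<longleftrightarrow> v \<in> c"
    "bot \<notin> point_filter c M" "top \<in> point_filter c M"
    "inf x y \<in> point_filter c M \<longleftrightarrow> x \<in> point_filter c M \<and> y \<in> point_filter c M"
    "sup x y \<in> point_filter c M \<longleftrightarrow> x \<in> point_filter c M \<or> y \<in> point_filter c M"
    "- x \<in> point_filter c M \<longleftrightarrow> (\<forall>d\<in>M. x \<notin> point_filter d {d})"
    unfolding tu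
    by (simp_all add: inf_free_pdl.abs_eq sup_free_pdl.abs_eq uminus_free_pdl.abs_eq
        bot_free_pdl.abs_eq top_free_pdl.abs_eq free_gen.abs_eq
        mem_point_filter_iff[OF assms] mem_point_filter_iff[OF point_singleton] sat_singleton)
qed

lemma prime_filter_point_filter:
  assumes "point c M"
  shows "prime_filter (point_filter c M)"
  by (rule prime_filterI) (simp_all add: point_filter_simps[OF assms])

lemma point_filter_mono: "c \<subseteq> c' \<Longrightarrow> M' \<subseteq> M \<Longrightarrow> point_filter c M \<subseteq> point_filter c' M'"
  unfolding point_filter_def using sat_mono by blast

text \<open>Completeness. Membership of a term in a maximal prime filter is decided by the colour of the
  filter, since there negation is classical; with this, the criterion for pseudocomplements turns
  membership in an arbitrary prime filter into truth at its point.\<close>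

lemma prime_filter_eq_point_filter:
  fixes R :: "'v free_pdl set"
  assumes R: "prime_filter R"
  obtains c M where "point c M" "R = point_filter c M"
proof -
  define colour where "colour = (\<lambda>U::'v free_pdl set. {v. free_gen v \<in> U})"
  define M where "M = colour ` max_above prime_filters R"
  note abs = inf_free_pdl.abs_eq[symmetric] sup_free_pdl.abs_eq[symmetric]
    uminus_free_pdl.abs_eq[symmetric] bot_free_pdl.abs_eq[symmetric] top_free_pdl.abs_eq[symmetric]
    free_gen.abs_eq[symmetric]
  have maximal: "abs_free_pdl t \<in> U \<longleftrightarrow> pdl_eval (\<lambda>v. v \<in> colour U) t"
    if U: "U \<in> max_above prime_filters R" for U t
  proof -
    have "prime_filter U" using U by (auto simp: max_above_iff prime_filters_def)
    then show ?thesis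
    proof (induction t)
      case (Var v)
      show ?case by (simp add: abs colour_def)
    qed (simp_all add: abs prime_filter_simps uminus_mem_maximal_iff[OF U])
  qed
  have "abs_free_pdl t \<in> R \<longleftrightarrow> sat (colour R) M t" for t
  proof (induction t)
    case (Var v)
    show ?case by (simp add: abs colour_def)
  next
    case (Neg t)
    show ?case by (simp add: abs uminus_mem_prime_filter_iff[OF R] M_def maximal)
  qed (simp_all add: abs prime_filter_simps[OF R])
  moreover have point: "point (colour R) M"
  proof -
    have "max_above prime_filters R \<noteq> {}"
      using uminus_mem_prime_filter_iff[OF R, of top] prime_filter_simps(3,4)[OF R] inf_uminus_bot[of "top :: 'v free_pdl"]
      by auto
    then show ?thesis unfolding point_def M_def colour_def by (auto simp: max_above_iff)
  qed
  ultimately have "z \<in> R \<longleftrightarrow> z \<in> point_filter (colour R) M" for z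
    by (cases z rule: abs_free_pdl_cases) (simp add: mem_point_filter_iff)
  then show ?thesis using that point by blast
qed

lemma free_pdl_eqI:
  assumes "\<And>c M. point c M \<Longrightarrow> x \<in> point_filter c M \<longleftrightarrow> y \<in> point_filter c M"
  shows "x = y"
  using assms by (metis eqI_prime_filters prime_filter_eq_point_filter)


section \<open>Definable sets of points\<close>

definition definable :: "('v set \<Rightarrow> 'v set set \<Rightarrow> bool) \<Rightarrow> bool" where
  "definable P \<longleftrightarrow> (\<exists>z. \<forall>c M. point c M \<longrightarrow> (z \<in> point_filter c M \<longleftrightarrow> P c M))"

lemma definableI:
  "(\<And>c M. point c M \<Longrightarrow> z \<in> point_filter c M \<longleftrightarrow> P c M) \<Longrightarrow> definable P"
  unfolding definable_def by blast

lemma definable_gen: "definable (\<lambda>c M. v \<in> c)"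
  by (rule definableI[of "free_gen v"]) (simp add: point_filter_simps)

lemma definable_conj: 
  assumes "definable P" "definable Q"
  shows "definable (\<lambda>c M. P c M \<and> Q c M)"
proof -
  obtain x y where "\<forall>c M. point c M \<longrightarrow> (x \<in> point_filter c M \<longleftrightarrow> P c M)"
    "\<forall>c M. point c M \<longrightarrow> (y \<in> point_filter c M \<longleftrightarrow> Q c M)"
    using assms unfolding definable_def by blast
  then show ?thesis by (intro definableI[of "inf x y"]) (simp add: point_filter_simps)
qed

lemma definable_disj: 
  assumes "definable P" "definable Q"
  shows "definable (\<lambda>c M. P c M \<or> Q c M)"
proof -
  obtain x y where "\<forall>c M. point c M \<longrightarrow> (x \<in> point_filter c M \<longleftrightarrow> P c M)"
    "\<forall>c M. point c M \<longrightarrow> (y \<in> point_filter c M \<longleftrightarrow> Q c M)"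
    using assms unfolding definable_def by blast
  then show ?thesis by (intro definableI[of "sup x y"]) (simp add: point_filter_simps)
qed

lemma definable_neg: 
  assumes "definable P"
  shows "definable (\<lambda>c M. \<forall>d\<in>M. \<not> P d {d})"
proof -
  obtain x where "\<forall>c M. point c M \<longrightarrow> (x \<in> point_filter c M \<longleftrightarrow> P c M)"
    using assms unfolding definable_def by blast
  then show ?thesis by (intro definableI[of "- x"]) (simp add: point_filter_simps)
qed

lemma definable_ball:
  assumes "finite I" "\<And>i. i \<in> I \<Longrightarrow> definable (P i)"
  shows "definable (\<lambda>c M. \<forall>i\<in>I. P i c M)"
  using assms
proof (induction I)
  case empty
  show ?case by (rule definableI[of top]) (simp add: point_filter_simps)
qed (simp add: definable_conj)

lemma definable_bex:
  assumes "finite I" "\<And>i. i \<in> I \<Longrightarrow> definable (P i)"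
  shows "definable (\<lambda>c M. \<exists>i\<in>I. P i c M)"
  using assms
proof (induction I)
  case empty
  show ?case by (rule definableI[of bot]) (simp add: point_filter_simps)
qed (simp add: definable_disj)

text \<open>An up-set that looks only at a finite set \<open>N\<close> of generators is a finite union of principal
  up-sets of points \<open>(c, M)\<close> over \<open>N\<close>. Such a principal up-set is defined by the conjunction of the
  generators in \<open>c\<close> with, for each colour \<open>d \<subseteq> N\<close> outside \<open>M\<close>, the negation of the term
  stating that the colour is \<open>d\<close>, namely the conjunction of the generators in \<open>d\<close> and the
  negations of those in \<open>N - d\<close>.\<close>

lemma definable_upset:
  assumes N: "finite N"
    and mono: "\<And>c M c' M'. P c M \<Longrightarrow> point c M \<Longrightarrow> point c' M' \<Longrightarrow> c \<subseteq> c' \<Longrightarrow> M' \<subseteq> M \<Longrightarrow> P c' M'"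
  shows "definable (\<lambda>c M. P (c \<inter> N) ((\<lambda>d. d \<inter> N) ` M))"
proof -
  \<comment> \<open>The inner quantifier over the singleton \<open>{d'}\<close> is negation evaluated at the maximal point
    \<open>(d', {d'})\<close>.\<close>
  have colour: "definable (\<lambda>c M. \<forall>d'\<in>M. d' \<inter> N \<noteq> d)" if "d \<subseteq> N" for d
  proof -
    have "finite d" "finite (N - d)" using N that finite_subset by auto
    then have "definable (\<lambda>c M. \<forall>d'\<in>M. \<not> ((\<forall>v\<in>d. v \<in> d') \<and> (\<forall>v\<in>N - d. \<forall>e\<in>{d'}. v \<notin> e)))"
      by (intro definable_neg[of "\<lambda>c M. (\<forall>v\<in>d. v \<in> c) \<and> (\<forall>v\<in>N - d. \<forall>e\<in>M. v \<notin> e)"]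
          definable_conj definable_ball definable_neg[OF definable_gen] definable_gen)
    moreover have "(\<forall>v\<in>d. v \<in> d') \<and> (\<forall>v\<in>N - d. \<forall>e\<in>{d'}. v \<notin> e) \<longleftrightarrow> d' \<inter> N = d" for d'
      using that by auto
    ultimately show ?thesis by (simp only:)
  qed
  define K where "K = {(c, M). c \<subseteq> N \<and> M \<subseteq> Pow N \<and> point c M \<and> P c M}"
  have finK: "finite K"
    by (rule finite_subset[of _ "Pow N \<times> Pow (Pow N)"]) (use N in \<open>auto simp: K_def\<close>)
  define Q where "Q = (\<lambda>c M. \<exists>k\<in>K. (\<forall>v\<in>fst k. v \<in> c) \<and> (\<forall>d\<in>Pow N - snd k. \<forall>d'\<in>M. d' \<inter> N \<noteq> d))"
  have "definable Q" unfolding Q_def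
  proof (intro definable_bex finK definable_conj definable_ball definable_gen)
    fix k assume "k \<in> K"
    then show "finite (fst k)" using N finite_subset unfolding K_def by auto
  qed (use N colour in auto)
  moreover have "Q c M \<longleftrightarrow> P (c \<inter> N) ((\<lambda>d. d \<inter> N) ` M)" if cM: "point c M" for c M
  proof -
    have pt: "point (c \<inter> N) ((\<lambda>d. d \<inter> N) ` M)" using cM unfolding point_def by auto
    show ?thesis
    proof
      assume "Q c M"
      then obtain c0 M0 where k: "(c0, M0) \<in> K" "c0 \<subseteq> c" "\<forall>d\<in>Pow N - M0. \<forall>d'\<in>M. d' \<inter> N \<noteq> d"
        unfolding Q_def by (elim bexE conjE) (metis prod.collapse subsetI)
      have "c0 \<subseteq> N" "point c0 M0" "P c0 M0" using k(1) by (simp_all add: K_def)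
      moreover have "(\<lambda>d. d \<inter> N) ` M \<subseteq> M0" using k(3) by auto
      ultimately show "P (c \<inter> N) ((\<lambda>d. d \<inter> N) ` M)" using mono[OF _ _ pt] k(2) by simp
    next
      assume "P (c \<inter> N) ((\<lambda>d. d \<inter> N) ` M)"
      then have "(c \<inter> N, (\<lambda>d. d \<inter> N) ` M) \<in> K" using pt unfolding K_def by auto
      then show "Q c M" unfolding Q_def by force
    qed
  qed
  ultimately show ?thesis unfolding definable_def by simp
qed


section \<open>Covers and free skeletons\<close>

text \<open>The maximal points above \<open>(c, M)\<close> must be sent exactly onto the maximal elements above
  \<open>k c M\<close>: this is the dual of preserving pseudocomplements. Surjectivity is the
  dual of injectivity.\<close>

definition cover :: "('v set \<Rightarrow> 'v set set \<Rightarrow> 'b::order) \<Rightarrow> 'b set \<Rightarrow> bool" where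
  "cover k X \<longleftrightarrow>
     (\<forall>c M. point c M \<longrightarrow> k c M \<in> X) \<and>
     (\<forall>c M. point c M \<longrightarrow> max_above X (k c M) = (\<lambda>d. k d {d}) ` M) \<and>
     (\<forall>c M c' M'. point c M \<and> point c' M' \<and> c \<subseteq> c' \<and> M' \<subseteq> M \<longrightarrow> k c M \<le> k c' M') \<and>
     (\<forall>x\<in>X. \<exists>c M. point c M \<and> k c M = x)"

text \<open>Shrinking \<open>M\<close> moves a point up and cuts down the maximal points above it at will, which gives
  the first two skeleton conditions for any choice of points over the elements of \<open>X\<close>. For the
  third, the point chosen over the minimum has to be the least point \<open>({}, UNIV)\<close>: then the point
  defining \<open>s m Y\<close> has all the colours sent into \<open>Y\<close>, so it lies below every point over
  an \<open>x\<close> with \<open>max \<up>x \<subseteq> Y\<close>.\<close>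

lemma has_free_skeleton_if_cover:
  fixes k :: "'v set \<Rightarrow> 'v set set \<Rightarrow> 'b::order"
  assumes "cover k X"
  shows "has_free_skeleton X"
proof -
  have mem: "\<And>c M. point c M \<Longrightarrow> k c M \<in> X"
    and maxs: "\<And>c M. point c M \<Longrightarrow> max_above X (k c M) = (\<lambda>d. k d {d}) ` M"
    and mono: "\<And>c M c' M'. point c M \<Longrightarrow> point c' M' \<Longrightarrow> c \<subseteq> c' \<Longrightarrow> M' \<subseteq> M \<Longrightarrow> k c M \<le> k c' M'"
    and onto: "\<And>x. x \<in> X \<Longrightarrow> \<exists>c M. point c M \<and> k c M = x"
    using assms unfolding cover_def by blast+
  define m where "m = k {} UNIV"
  have point_m: "point ({} :: 'v set) UNIV" unfolding point_def by simp
  have least: "m \<le> x" if "x \<in> X" for x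
    using onto[OF that] mono[OF point_m] unfolding m_def by blast
  have "\<exists>cM. \<forall>x\<in>X. point (fst (cM x)) (snd (cM x)) \<and> k (fst (cM x)) (snd (cM x)) = x \<and>
      (x = m \<longrightarrow> cM x = ({}, UNIV))"
  proof (rule bchoice, intro ballI)
    fix x assume "x \<in> X"
    then show "\<exists>y. point (fst y) (snd y) \<and> k (fst y) (snd y) = x \<and> (x = m \<longrightarrow> y = ({}, UNIV))"
    proof (cases "x = m")
      case True
      then show ?thesis using point_m m_def by auto
    next
      case False
      then show ?thesis using onto[OF \<open>x \<in> X\<close>] by auto
    qed
  qed
  then obtain cM where cM: "\<And>x. x \<in> X \<Longrightarrow> point (fst (cM x)) (snd (cM x))"
    "\<And>x. x \<in> X \<Longrightarrow> k (fst (cM x)) (snd (cM x)) = x" and cM_m: "m \<in> X \<Longrightarrow> cM m = ({}, UNIV)"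
    by blast
  define restr where "restr = (\<lambda>x Y. {d \<in> snd (cM x). k d {d} \<in> Y})"
  define s where "s = (\<lambda>x Y. k (fst (cM x)) (restr x Y))"
  have mX: "m \<in> X" using mem[OF point_m] unfolding m_def .
  have image: "(\<lambda>d. k d {d}) ` restr x Y = Y" if "x \<in> X" "Y \<subseteq> max_above X x" for x Y
    using that maxs[OF cM(1)[OF that(1)]] cM(2)[OF that(1)] unfolding restr_def by auto
  have pt: "point (fst (cM x)) (restr x Y)" if "x \<in> X" "Y \<noteq> {}" "Y \<subseteq> max_above X x" for x Y
    using image[OF that(1,3)] that(2) cM(1)[OF that(1)] unfolding point_def
    by (auto simp: restr_def)
  have skel1: "s x Y \<in> up_in X x \<and> Y = max_above X (s x Y)"
    if xY: "x \<in> X" "Y \<noteq> {}" "Y \<subseteq> max_above X x" for x Y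
  proof -
    have "k (fst (cM x)) (snd (cM x)) \<le> s x Y"
      unfolding s_def by (rule mono[OF cM(1)[OF xY(1)] pt[OF xY]]) (auto simp: restr_def)
    then show ?thesis
      using cM(2)[OF xY(1)] mem[OF pt[OF xY]] maxs[OF pt[OF xY]] image[OF xY(1,3)]
      by (simp add: up_in_def s_def)
  qed
  have skel2: "s x Z \<le> s x Y"
    if "x \<in> X" "Y \<noteq> {}" "Z \<noteq> {}" "Y \<subseteq> max_above X x" "Z \<subseteq> max_above X x" "Y \<subseteq> Z" for x Y Z
    unfolding s_def using that by (intro mono pt) (auto simp: restr_def)
  have max_m: "max_above X m = max_elems X"
    using max_above_least least by blast
  have skel3: "s m Y \<le> x" if x: "x \<in> X" and Y: "Y \<noteq> {}" "Y \<subseteq> max_elems X" "max_above X x \<subseteq> Y" for x Y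
  proof -
    have "snd (cM x) \<subseteq> restr m Y"
      using maxs[OF cM(1)[OF x]] cM(2)[OF x] Y(3) cM_m[OF mX] unfolding restr_def by auto
    then have "s m Y \<le> k (fst (cM x)) (snd (cM x))"
      unfolding s_def using Y cM_m[OF mX] max_m by (intro mono pt mX cM(1) x) auto
    then show ?thesis using cM(2)[OF x] by simp
  qed
  show ?thesis
    unfolding has_free_skeleton_def
  proof (intro bexI[of _ m] conjI exI[of _ s] ballI allI impI)
    fix x Y assume "x \<in> X" "Y \<noteq> {} \<and> Y \<subseteq> max_above X x"
    then show "s x Y \<in> up_in X x" "Y = max_above X (s x Y)" using skel1 by blast+
  qed (use mX least skel2 skel3 in auto)
qed

text \<open>The colour \<open>{e (x, u)}\<close> names the maximal element \<open>u\<close> and says that it is meant as an element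
  above \<open>x\<close>; \<open>q\<close> extracts the name, and \<open>base M\<close> is the \<open>x\<close> on which all members of \<open>M\<close> agree, or
  \<open>m\<close> if there is none. As the blocks are disjoint, shrinking \<open>M\<close> either leaves the base alone or
  moves it away from \<open>m\<close>. These are the cases of monotonicity, covered by the second and third
  skeleton conditions.\<close>

lemma cover_if_has_free_skeleton:
  fixes X :: "'b::order set"
  assumes X: "finite X" and "has_free_skeleton X"
  obtains k :: "nat set \<Rightarrow> nat set set \<Rightarrow> 'b" and N
  where "cover k X" "finite N" "\<And>c M. k c M = k (c \<inter> N) ((\<lambda>d. d \<inter> N) ` M)"
proof -
  from assms(2) obtain m s0 where mX: "m \<in> X" and least: "\<And>x. x \<in> X \<Longrightarrow> m \<le> x"
    and s0: "\<And>x Y. x \<in> X \<Longrightarrow> Y \<noteq> {} \<Longrightarrow> Y \<subseteq> max_above X x \<Longrightarrow>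
      s0 x Y \<in> up_in X x \<and> Y = max_above X (s0 x Y)"
      "\<And>x Y Z. x \<in> X \<Longrightarrow> Y \<noteq> {} \<Longrightarrow> Z \<subseteq> max_above X x \<Longrightarrow> Y \<subseteq> Z \<Longrightarrow> s0 x Z \<le> s0 x Y"
      "\<And>x Y. x \<in> X \<Longrightarrow> Y \<noteq> {} \<Longrightarrow> Y \<subseteq> max_elems X \<Longrightarrow> max_above X x \<subseteq> Y \<Longrightarrow> s0 m Y \<le> x"
    unfolding has_free_skeleton_def by (smt (verit) order_trans subset_empty)
  have max_m: "max_above X m = max_elems X"
    using max_above_least least by blast
  have max_sub: "max_above X x \<subseteq> max_elems X" for x
    unfolding max_elems_def up_in_def by auto
  have max_ne: "max_above X x \<noteq> {}" if x: "x \<in> X" for x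
  proof -
    obtain u where "u \<in> X" "x \<le> u" "\<forall>z\<in>X. u \<le> z \<longrightarrow> u = z"
      using finite_has_maximal2[OF X x] by blast
    then have "u \<in> max_above X x" unfolding max_above_iff by blast
    then show ?thesis by blast
  qed
  \<comment> \<open>A skeleton may have \<open>s0 x (max \<up>x)\<close> strictly above \<open>x\<close>. Replacing this value by \<open>x\<close> keeps the
    three conditions and makes every \<open>x\<close> a value, as needed for surjectivity.\<close>
  define s where "s = (\<lambda>x Y. if Y = max_above X x then x else s0 x Y)"
  have s_mem: "s x Y \<in> X" "x \<le> s x Y" and s_max: "max_above X (s x Y) = Y"
    if "x \<in> X" "Y \<noteq> {}" "Y \<subseteq> max_above X x" for x Y
    using s0(1)[OF that] that(1) by (auto simp: s_def up_in_def)
  have s_anti: "s x Z \<le> s x Y" if xYZ: "x \<in> X" "Y \<noteq> {}" "Z \<subseteq> max_above X x" "Y \<subseteq> Z" for x Y Z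
  proof (cases "Z = max_above X x")
    case True
    then show ?thesis using s_mem(2) xYZ by (simp add: s_def)
  next
    case False
    then have "Y \<noteq> max_above X x" using xYZ by blast
    then show ?thesis using False s0(2)[OF xYZ] by (simp add: s_def)
  qed
  have s_bot: "s m Y \<le> x" if "x \<in> X" "Y \<subseteq> max_elems X" "max_above X x \<subseteq> Y" for x Y
  proof -
    have "Y \<noteq> {}" using max_ne that by blast
    then show ?thesis using s0(3) least that by (auto simp: s_def)
  qed

  obtain e :: "'b \<times> 'b \<Rightarrow> nat" where e: "inj_on e (X \<times> X)"
    using finite_imp_inj_to_nat_seg[of "X \<times> X"] X by auto
  define N where "N = e ` (X \<times> X)"
  define block where "block = (\<lambda>x. (\<lambda>u. {e (x, u)}) ` max_above X x)"
  obtain q where q: "\<And>x u. x \<in> X \<Longrightarrow> u \<in> max_above X x \<Longrightarrow> q {e (x, u)} = u"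
    and q_max: "\<And>d. q d \<in> max_elems X"
  proof -
    obtain u0 where u0: "u0 \<in> max_elems X" using max_ne[OF mX] max_sub by blast
    define q where "q = (\<lambda>d. if \<exists>x\<in>X. d \<in> block x then snd (inv_into (X \<times> X) e (the_elem d)) else u0)"
    have "q {e (x, u)} = u" if "x \<in> X" "u \<in> max_above X x" for x u
    proof -
      have "u \<in> X" using that(2) by (simp add: max_above_iff)
      then have "inv_into (X \<times> X) e (e (x, u)) = (x, u)" using e that(1) by simp
      moreover have "{e (x, u)} \<in> block x" using that by (auto simp: block_def)
      ultimately show ?thesis using that(1) by (auto simp: q_def)
    qed
    moreover from this have "q d \<in> max_elems X" for d
    proof (cases "\<exists>x\<in>X. d \<in> block x")
      case True
      then show ?thesis using calculation max_sub by (fastforce simp: block_def)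
    next
      case False
      then show ?thesis using u0 by (simp add: q_def)
    qed
    ultimately show ?thesis using that by blast
  qed
  have q_block: "q ` block x = max_above X x" if "x \<in> X" for x
    unfolding block_def image_image using q that by simp
  have block_unique: "x = y" if "x \<in> X" "y \<in> X" "d \<in> block x" "d \<in> block y" for x y d
    using that inj_onD[OF e] by (fastforce simp: block_def max_above_iff)

  define base where "base = (\<lambda>M. if \<exists>x\<in>X. M \<subseteq> block x then SOME x. x \<in> X \<and> M \<subseteq> block x else m)"
  have base_eq: "base M = x" if "M \<noteq> {}" "x \<in> X" "M \<subseteq> block x" for M x
  proof -
    have "(SOME x. x \<in> X \<and> M \<subseteq> block x) = x"
      by (rule some_equality) (use that block_unique in blast)+
    then show ?thesis using that by (auto simp: base_def)
  qed
  have base: "base M \<in> X" "q ` M \<subseteq> max_above X (base M)" if "M \<noteq> {}" for M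
  proof -
    have "base M \<in> X \<and> q ` M \<subseteq> max_above X (base M)"
    proof (cases "\<exists>x\<in>X. M \<subseteq> block x")
      case True
      then show ?thesis using base_eq[OF that] q_block by blast
    next
      case False
      then show ?thesis using mX q_max max_m by (auto simp: base_def)
    qed
    then show "base M \<in> X" "q ` M \<subseteq> max_above X (base M)" by auto
  qed
  have base_mono: "base M' = base M \<or> base M = m" if "M' \<subseteq> M" "M' \<noteq> {}" for M M'
  proof (cases "\<exists>x\<in>X. M \<subseteq> block x")
    case True
    then obtain x where "x \<in> X" "M \<subseteq> block x" by blast
    then show ?thesis using base_eq[of M x] base_eq[of M' x] that by auto
  qed (simp add: base_def)

  \<comment> \<open>Maximal points need a separate clause because \<open>s x {u}\<close> may lie strictly below \<open>u\<close>.\<close>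
  define k where "k = (\<lambda>c M. if M = {c} then q c else s (base M) (q ` M))"
  have q_single: "q d \<in> X" "max_above X (q d) = {q d}" for d
    using q_max[of d] unfolding max_elems_def up_in_def by auto
  have k_mem: "k c M \<in> X" and k_max: "max_above X (k c M) = q ` M" if "point c M" for c M
    using that s_mem(1)[OF base(1) _ base(2)] s_max[OF base(1) _ base(2)] q_single
    by (auto simp: k_def point_def)
  have k_mono: "k c M \<le> k c' M'" if pts: "point c M" "point c' M'" "c \<subseteq> c'" "M' \<subseteq> M" for c M c' M'
  proof -
    have ne: "M \<noteq> {}" "M' \<noteq> {}" using pts unfolding point_def by auto
    consider "M = {c}" | "M \<noteq> {c}" "M' = {c'}" | "M \<noteq> {c}" "M' \<noteq> {c'}" by blast
    then show ?thesis
    proof cases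
      case 1
      then have "M' = {c}" using pts(4) ne by blast
      moreover from this have "c' = c" using pts(2,3) unfolding point_def by auto
      ultimately show ?thesis using 1 by simp
    next
      case 2
      then have "q c' \<in> max_above X (k c M)" using k_max[OF pts(1)] pts(4) by blast
      then show ?thesis using 2 by (simp add: k_def max_above_iff)
    next
      case 3
      show ?thesis
      proof (cases "base M = m")
        case True
        then have "k c M = s m (q ` M)" using 3 by (simp add: k_def)
        moreover have "max_above X (k c' M') \<subseteq> q ` M" using k_max[OF pts(2)] pts(4) by blast
        ultimately show ?thesis using s_bot[OF k_mem[OF pts(2)]] q_max by (simp add: image_subset_iff)
      next
        case False
        then have "base M' = base M" using base_mono pts(4) ne by blast
        then show ?thesis using 3 s_anti base[OF ne(1)] pts(4) ne by (simp add: k_def image_mono)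
      qed
    qed
  qed
  have k_onto: "point {} (block x) \<and> k {} (block x) = x" if x: "x \<in> X" for x
  proof -
    have ne: "block x \<noteq> {}" using max_ne[OF x] by (simp add: block_def)
    then have "base (block x) = x" using base_eq x by blast
    \<comment> \<open>Colours in a block are nonempty, so the point \<open>({}, block x)\<close> is not maximal.\<close>
    moreover have "block x \<noteq> {{}}" by (auto simp: block_def)
    ultimately show ?thesis using ne q_block[OF x] by (simp add: k_def s_def point_def)
  qed

  \<comment> \<open>Only finitely many generators occur in the blocks, and restricting all colours to them gives
    a cover that looks only at these.\<close>
  define k' where "k' = (\<lambda>c M. k (c \<inter> N) ((\<lambda>d. d \<inter> N) ` M))"
  have pt: "point (c \<inter> N) ((\<lambda>d. d \<inter> N) ` M)" if "point c M" for c M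
    using that unfolding point_def by auto
  have "cover k' X"
    unfolding cover_def
  proof (intro conjI allI impI ballI)
    fix c M assume "point (c :: nat set) M"
    then show "k' c M \<in> X" unfolding k'_def by (intro k_mem pt)
  next
    fix c M assume cM: "point (c :: nat set) M"
    have "k' d {d} = q (d \<inter> N)" for d by (simp add: k'_def k_def)
    then show "max_above X (k' c M) = (\<lambda>d. k' d {d}) ` M"
      using k_max[OF pt[OF cM]] by (simp add: k'_def image_image)
  next
    fix c M c' M' assume "point (c :: nat set) M \<and> point c' M' \<and> c \<subseteq> c' \<and> M' \<subseteq> M"
    then show "k' c M \<le> k' c' M'" unfolding k'_def by (intro k_mono pt) auto
  next
    fix x assume x: "x \<in> X"
    have "d \<inter> N = d" if "d \<in> block x" for d
      using that x by (auto simp: block_def N_def max_above_iff)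
    then have "k' {} (block x) = k {} (block x)" by (simp add: k'_def)
    then show "\<exists>c M. point c M \<and> k' c M = x" using k_onto[OF x] by auto
  qed
  moreover have "finite N" using X by (simp add: N_def)
  moreover have "k' c M = k' (c \<inter> N) ((\<lambda>d. d \<inter> N) ` M)" for c M
    by (simp add: k'_def image_image Int_assoc)
  ultimately show ?thesis using that by blast
qed


section \<open>Covers and embeddings\<close>

lemma finite_filter_least:
  fixes F :: "'a::{finite, lattice} set"
  assumes "lattice_filter F"
  obtains a where "a \<in> F" "\<And>b. b \<in> F \<Longrightarrow> a \<le> b"
proof -
  have "\<exists>a\<in>F. \<forall>b\<in>S. a \<le> b" if "S \<subseteq> F" for S
    using finite[of S] that
  proof (induction S)
    case empty
    then show ?case using assms unfolding lattice_filter_def by blast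
  next
    case (insert b S)
    then obtain a where "a \<in> F" "\<forall>b\<in>S. a \<le> b" by blast
    then have "inf a b \<in> F" "\<forall>b'\<in>insert b S. inf a b \<le> b'"
      using insert.prems assms unfolding lattice_filter_def by (auto intro: le_infI1)
    then show ?case by blast
  qed
  from this[of F] show ?thesis using that by blast
qed

text \<open>Surjectivity is the prime filter theorem: the images of a prime filter \<open>x\<close> and of its complement
  generate a disjoint filter and ideal in the free algebra. Finiteness is used for the maximal
  elements: an infinite \<open>M\<close> need not contain the colours of all maximal prime filters above
  \<open>point_filter c M\<close>, but a maximal \<open>Q\<close> of the finite algebra has a least element \<open>a\<close>, and
  \<open>-a \<notin> Q\<close> already provides some \<open>d \<in> M\<close> whose filter contains \<open>h a\<close>, hence all of \<open>h ` Q\<close>.\<close>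

lemma cover_if_embedding:
  fixes h :: "'a::{finite, pseudocomplemented_distrib_lattice} \<Rightarrow> 'v free_pdl"
  assumes "pdl_embedding h"
  shows "cover (\<lambda>c M. h -` point_filter c M) (prime_filters :: 'a set set)"
proof -
  have h: "\<And>x y. h (inf x y) = inf (h x) (h y)" "\<And>x y. h (sup x y) = sup (h x) (h y)"
    "\<And>x. h (- x) = - h x" "h bot = bot" "h top = top" and inj: "inj h"
    using assms unfolding pdl_embedding_def pdl_hom_def by auto
  have h_mono: "x \<le> y \<Longrightarrow> h x \<le> h y" for x y by (metis h(1) le_iff_inf)
  have h_reflect: "x \<le> y" if "h x \<le> h y" for x y
    using that inj by (metis h(1) injD le_iff_inf)
  have prime: "prime_filter (h -` R)" if "prime_filter R" for R
    by (rule prime_filterI) (simp_all add: h prime_filter_simps[OF that])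
  show ?thesis
    unfolding cover_def
  proof (intro conjI allI impI ballI)
    fix c M assume "point (c :: 'v set) M"
    then show "h -` point_filter c M \<in> prime_filters"
      by (simp add: prime_filters_def prime prime_filter_point_filter)
  next
    fix c M c' M' assume "point (c :: 'v set) M \<and> point c' M' \<and> c \<subseteq> c' \<and> M' \<subseteq> M"
    then show "h -` point_filter c M \<le> h -` point_filter c' M'"
      using point_filter_mono by (meson vimage_mono)
  next
    fix x assume "x \<in> (prime_filters :: 'a set set)"
    then have x: "prime_filter x" by (simp add: prime_filters_def)
    define G where "G = {z. \<exists>a\<in>x. h a \<le> z}"
    define I where "I = {z. \<exists>a. a \<notin> x \<and> z \<le> h a}"
    have "lattice_filter G"
      unfolding lattice_filter_def
    proof (intro conjI allI impI)
      show "G \<noteq> {}" using prime_filter_simps(3)[OF x] unfolding G_def by blast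
    next
      fix y z assume "y \<in> G \<and> y \<le> z"
      then show "z \<in> G" unfolding G_def by (auto intro: order_trans)
    next
      fix y z assume "y \<in> G \<and> z \<in> G"
      then obtain a b where "a \<in> x" "b \<in> x" "h a \<le> y" "h b \<le> z" unfolding G_def by blast
      then have "inf a b \<in> x" "h (inf a b) \<le> inf y z"
        using prime_filter_simps(1)[OF x] by (simp_all only: h inf_mono)
      then show "inf y z \<in> G" unfolding G_def by blast
    qed
    moreover have "G \<inter> I = {}"
    proof -
      have "b \<in> x" if "a \<in> x" "h a \<le> z" "z \<le> h b" for a b z
        using that x h_reflect[of a b] unfolding prime_filter_def by (meson order_trans)
      then show ?thesis unfolding G_def I_def by blast
    qed
    moreover have "I \<noteq> {}" using prime_filter_simps(4)[OF x] unfolding I_def by blast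
    moreover have "y \<in> I" if "z \<in> I" "y \<le> z" for y z
      using that unfolding I_def by (auto intro: order_trans)
    moreover have "sup y z \<in> I" if yz: "y \<in> I" "z \<in> I" for y z
    proof -
      obtain a b where "a \<notin> x" "b \<notin> x" "y \<le> h a" "z \<le> h b" using yz unfolding I_def by blast
      then have "sup a b \<notin> x" "sup y z \<le> h (sup a b)"
        using prime_filter_simps(2)[OF x] by (simp_all only: h sup_mono simp_thms)
      then show ?thesis unfolding I_def by blast
    qed
    ultimately obtain R where R: "prime_filter R" "G \<subseteq> R" "R \<inter> I = {}"
      by (rule prime_filter_extension)
    have "h -` R = x" using R(2,3) unfolding G_def I_def by auto
    moreover obtain c M where "point c M" "R = point_filter c M"
      using prime_filter_eq_point_filter[OF R(1)] .
    ultimately show "\<exists>c M. point c M \<and> h -` point_filter c M = x" by blast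
  next
    fix c M assume cM: "point (c :: 'v set) M"
    show "max_above prime_filters (h -` point_filter c M) = (\<lambda>d. h -` point_filter d {d}) ` M"
    proof (intro equalityI subsetI)
      fix Q assume Q: "Q \<in> max_above prime_filters (h -` point_filter c M)"
      then have prime_Q: "prime_filter Q" and sub: "h -` point_filter c M \<subseteq> Q"
        and max: "\<And>V. prime_filter V \<Longrightarrow> Q \<subseteq> V \<Longrightarrow> V = Q"
        by (auto simp: max_above_iff prime_filters_def)
      obtain a where a: "a \<in> Q" "\<And>b. b \<in> Q \<Longrightarrow> a \<le> b"
        using finite_filter_least[OF prime_filter_lattice_filter[OF prime_Q]] by blast
      have "- a \<notin> Q" using a(1) uminus_mem_maximal_iff[OF Q] by blast
      then have "- h a \<notin> point_filter c M" using sub h(3) by force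
      then obtain d where d: "d \<in> M" "h a \<in> point_filter d {d}"
        using point_filter_simps(6)[OF cM] by blast
      have prime_d: "prime_filter (h -` point_filter d {d})"
        by (simp add: prime prime_filter_point_filter)
      then have "Q \<subseteq> h -` point_filter d {d}"
        using a(2) d(2) unfolding prime_filter_def by blast
      then show "Q \<in> (\<lambda>d. h -` point_filter d {d}) ` M" using max[OF prime_d] d(1) by blast
    next
      fix Q assume "Q \<in> (\<lambda>d. h -` point_filter d {d}) ` M"
      then obtain d where d: "d \<in> M" "Q = h -` point_filter d {d}" by blast
      show "Q \<in> max_above prime_filters (h -` point_filter c M)"
      proof (rule complemented_prime_filter_maximal)
        show "prime_filter Q" unfolding d(2) by (simp add: prime prime_filter_point_filter)
        have "c \<subseteq> d" using cM d(1) unfolding point_def by blast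
        then show "h -` point_filter c M \<subseteq> Q"
          unfolding d(2) using d(1) by (intro vimage_mono point_filter_mono) auto
        show "- x \<in> Q" if "x \<notin> Q" for x
          using that unfolding d(2) by (simp add: h point_filter_simps)
      qed
    qed
  qed
qed

text \<open>Since an element of the free algebra is determined by the points at which it holds, the
  homomorphism laws for \<open>h\<close> can be checked at each point. There they are the defining properties of
  the prime filter \<open>k c M\<close>, and for pseudocomplements the condition on maximal elements.\<close>

lemma embedding_if_cover:
  fixes k :: "'v set \<Rightarrow> 'v set set \<Rightarrow> 'a::pseudocomplemented_distrib_lattice set"
  assumes k: "cover k prime_filters" and N: "finite N"
    and k_N: "\<And>c M. k c M = k (c \<inter> N) ((\<lambda>d. d \<inter> N) ` M)"
  obtains h :: "'a \<Rightarrow> 'v free_pdl" where "pdl_embedding h"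
proof -
  have prime: "prime_filter (k c M)"
    and maxs: "max_above prime_filters (k c M) = (\<lambda>d. k d {d}) ` M" if "point c M" for c M
    using k that by (simp_all add: cover_def prime_filters_def)
  have mono: "k c M \<subseteq> k c' M'" if "point c M" "point c' M'" "c \<subseteq> c'" "M' \<subseteq> M" for c M c' M'
    using k that unfolding cover_def by blast
  have onto: "\<exists>c M. point c M \<and> k c M = x" if "prime_filter x" for x
    using k that unfolding cover_def prime_filters_def by blast
  have "definable (\<lambda>c M. a \<in> k c M)" for a
  proof -
    have "definable (\<lambda>c M. a \<in> k (c \<inter> N) ((\<lambda>d. d \<inter> N) ` M))"
      by (rule definable_upset[OF N]) (use mono in blast)
    then show ?thesis by (simp flip: k_N)
  qed
  then obtain h where h: "\<And>a c M. point c M \<Longrightarrow> h a \<in> point_filter c M \<longleftrightarrow> a \<in> k c M"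
    unfolding definable_def by metis
  have "h (- a) = - h a" for a
  proof (rule free_pdl_eqI)
    fix c M assume "point (c :: 'v set) M"
    then show "h (- a) \<in> point_filter c M \<longleftrightarrow> - h a \<in> point_filter c M"
      by (simp add: h point_filter_simps uminus_mem_prime_filter_iff[OF prime] maxs)
  qed
  moreover have "h (inf a b) = inf (h a) (h b)" "h (sup a b) = sup (h a) (h b)"
    "h bot = bot" "h top = top" for a b
    by (rule free_pdl_eqI; simp add: h point_filter_simps prime_filter_simps[OF prime])+
  moreover have "inj h"
  proof (rule injI, rule eqI_prime_filters)
    fix a b x assume "h a = h b" "prime_filter (x :: 'a set)"
    then show "a \<in> x \<longleftrightarrow> b \<in> x" using onto h by metis
  qed
  ultimately have "pdl_embedding h" unfolding pdl_embedding_def pdl_hom_def by blast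
  then show ?thesis using that by blast
qed

theorem proposition6p2:
  "(\<exists>h :: 'a::{finite, pseudocomplemented_distrib_lattice} \<Rightarrow> nat free_pdl. pdl_embedding h) \<longleftrightarrow>
   has_free_skeleton (prime_filters :: 'a set set)"
proof
  assume "\<exists>h :: 'a \<Rightarrow> nat free_pdl. pdl_embedding h"
  then show "has_free_skeleton (prime_filters :: 'a set set)"
    using cover_if_embedding has_free_skeleton_if_cover by blast
next
  assume "has_free_skeleton (prime_filters :: 'a set set)"
  then obtain k :: "nat set \<Rightarrow> nat set set \<Rightarrow> 'a set" and N
    where "cover k prime_filters" "finite N" "\<And>c M. k c M = k (c \<inter> N) ((\<lambda>d. d \<inter> N) ` M)"
    using cover_if_has_free_skeleton[OF finite] by blast
  then show "\<exists>h :: 'a \<Rightarrow> nat free_pdl. pdl_embedding h"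
    using embedding_if_cover[of k N] by metis
qed

end
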